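(* Let $X,Y\subset\mathbb{R}^n$ be arbitrary finite sets and let $f\colon X\to\{-1,1\}$ and $g\colon Y\to\{-1,1\}$ be functions that are not identically false (i.e., $f\not\equiv 1$ and $g\not\equiv 1$). Let $d=\deg_{\pm}(f\wedge g)$. Then there exist rational functions $p_1(x)/q_1(x)$ and $p_2(y)/q_2(y)$ of degree at most $4d$, with $q_1$ nonvanishing on $X$ and $q_2$ nonvanishing on $Y$, such that \[\max_{x\in X}\left|f(x)-\frac{p_1(x)}{q_1(x)}\right|+\max_{y\in Y}\left|g(y)-\frac{p_2(y)}{q_2(y)}\right|<1.\]
   Context: Boolean values: $-1$ is "true", $+1$ is "false". The function $f\wedge g\colon X\times Y\to\{-1,1\}$ is $(x,y)\mapsto f(x)\wedge g(y)$ (on a finite subset of $\mathbb{R}^{2n}$). The threshold degree $\deg_{\pm}(h)$ of $h\colon Z\to\{-1,1\}$, $Z$ finite, is the least total degree of a real polynomial $p$ with $h(z)p(z)>0$ on $Z$. The degree of a rational function $p/q$ is $\max(\deg p,\deg q)$ (total degrees). *)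

theory Defs
  imports "HOL-Analysis.Analysis" "HOL-Library.Poly_Mapping"
begin

text \<open>Real polynomials in variables indexed by a finite type: finitely supported maps from
  monomials (finitely supported exponent maps) to coefficients.\<close>

type_synonym 'v rpoly = "('v \<Rightarrow>\<^sub>0 nat) \<Rightarrow>\<^sub>0 real"

definition monom_degree :: "('v \<Rightarrow>\<^sub>0 nat) \<Rightarrow> nat" where
  "monom_degree m = (\<Sum>i\<in>Poly_Mapping.keys m. Poly_Mapping.lookup m i)"

text \<open>The zero polynomial gets degree 0.\<close>

definition total_degree :: "'v rpoly \<Rightarrow> nat" where
  "total_degree p = Max (insert 0 (monom_degree ` Poly_Mapping.keys p))"

definition eval_rpoly :: "('v::finite) rpoly \<Rightarrow> real ^ 'v \<Rightarrow> real" where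
  "eval_rpoly p x =
    (\<Sum>m\<in>Poly_Mapping.keys p. Poly_Mapping.lookup p m *
     (\<Prod>i\<in>UNIV. (x $ i) ^ Poly_Mapping.lookup m i))"

definition ratfun_degree :: "'v rpoly \<Rightarrow> 'v rpoly \<Rightarrow> nat" where
  "ratfun_degree p q = max (total_degree p) (total_degree q)"

text \<open>Only meaningful for finite \<open>Z\<close> and \<open>h\<close> nonvanishing on \<open>Z\<close>, where a
  sign-representing polynomial exists by interpolation.\<close>

definition threshold_degree :: "(real ^ 'v::finite) set \<Rightarrow> (real ^ 'v \<Rightarrow> real) \<Rightarrow> nat" where
  "threshold_degree Z h =
     (LEAST d. \<exists>p. total_degree p = d \<and> (\<forall>z\<in>Z. h z * eval_rpoly p z > 0))"

text \<open>Boolean conjunction where \<open>-1\<close> is true and \<open>1\<close> is false.\<close>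

definition sign_and :: "real \<Rightarrow> real \<Rightarrow> real" where
  "sign_and a b = (if a = -1 \<and> b = -1 then -1 else 1)"

text \<open>Euclidean space of dimension \<open>2n\<close> is the space with index type \<open>'n + 'n\<close>.\<close>

definition vec_append :: "real ^ 'n::finite \<Rightarrow> real ^ 'm::finite \<Rightarrow> real ^ ('n + 'm)" where
  "vec_append x y = (\<chi> i. case i of Inl j \<Rightarrow> x $ j | Inr k \<Rightarrow> y $ k)"

definition vec_left :: "real ^ ('n::finite + 'm::finite) \<Rightarrow> real ^ 'n" where
  "vec_left z = (\<chi> j. z $ Inl j)"

definition vec_right :: "real ^ ('n::finite + 'm::finite) \<Rightarrow> real ^ 'm" where
  "vec_right z = (\<chi> k. z $ Inr k)"

definition vec_times ::
    "(real ^ 'n::finite) set \<Rightarrow> (real ^ 'm::finite) set \<Rightarrow> (real ^ ('n + 'm)) set" where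
  "vec_times X Y = (\<lambda>(x, y). vec_append x y) ` (X \<times> Y)"

definition conj_fun ::
    "(real ^ 'n::finite \<Rightarrow> real) \<Rightarrow> (real ^ 'm::finite \<Rightarrow> real) \<Rightarrow> real ^ ('n + 'm) \<Rightarrow> real" where
  "conj_fun f g z = sign_and (f (vec_left z)) (g (vec_right z))"

lemma vec_left_append [simp]: "vec_left (vec_append x y) = x"
  by (simp add: vec_left_def vec_append_def vec_eq_iff)

lemma vec_right_append [simp]: "vec_right (vec_append x y) = y"
  by (simp add: vec_right_def vec_append_def vec_eq_iff)

lemma conj_fun_append: "conj_fun f g (vec_append x y) = sign_and (f x) (g y)"
  by (simp add: conj_fun_def)

end

theory Submission imports Defs begin

text \<open>
  Let \<open>\<phi>(x, y)\<close> be positive where \<open>f\<close> and \<open>g\<close> are both true and negative elsewhere, of degree \<open>d\<close>.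
  Say that \<open>X\<close> is separated at level \<open>c > 0\<close> if a rational function \<open>p / q\<close> of degree \<open>d\<close> maps the true
  points of \<open>f\<close> into \<open>(0, c]\<close> and its false points into \<open>(-\<infinity>, -1]\<close>. Taking \<open>p\<close> and \<open>-q\<close> to be nonnegative
  combinations of the sections \<open>\<phi>(\<sqdot>, y)\<close> over true and over false \<open>y\<close> respectively turns this into a system
  of linear inequalities, and its Gordan dual says precisely that \<open>Y\<close> is separated at level \<open>1 / c\<close>.
  Halving \<open>c\<close> until \<open>X\<close> stops being separated yields a \<open>c\<close> such that \<open>X\<close> is separated at level \<open>c\<close> and
  \<open>Y\<close> at level \<open>2 / c\<close>. A fixed quadratic rational function then turns level \<open>c\<close> into an
  approximation of \<open>f\<close> with error \<open>(A - 1) / (A + 1)\<close>, where \<open>A = \<surd>(1 + c)\<close>; two such errors, for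
  \<open>A\<close> and \<open>B\<close>, add up to less than 1 iff \<open>(A - 1)(B - 1) < 4\<close>, and here
  \<open>(A - 1)\<^sup>2 (B - 1)\<^sup>2 \<le> c (2 / c) = 2\<close>.
\<close>

section \<open>Polynomial functions of bounded degree\<close>

text \<open>Working with functions instead of formal polynomials makes closure under sums, products
  and sections a statement about values; a representing polynomial is extracted only where one is
  required.\<close>

definition polyfuns :: "nat \<Rightarrow> (real ^ 'v::finite \<Rightarrow> real) set" where
  "polyfuns d = {F. \<exists>p. total_degree p \<le> d \<and> F = eval_rpoly p}"

lemma total_degree_le_iff:
  "total_degree p \<le> d \<longleftrightarrow> (\<forall>m\<in>Poly_Mapping.keys p. monom_degree m \<le> d)"
  by (simp add: total_degree_def)

lemma monom_degree_eq_sum_UNIV: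
  fixes m :: "'v::finite \<Rightarrow>\<^sub>0 nat"
  shows "monom_degree m = (\<Sum>i\<in>UNIV. Poly_Mapping.lookup m i)"
  unfolding monom_degree_def by (rule sum.mono_neutral_left) (auto simp: in_keys_iff)

lemma eval_rpoly_eq_sum_superset:
  assumes "finite K" "Poly_Mapping.keys p \<subseteq> K"
  shows "eval_rpoly p x =
    (\<Sum>m\<in>K. Poly_Mapping.lookup p m * (\<Prod>i\<in>UNIV. (x $ i) ^ Poly_Mapping.lookup m i))"
  unfolding eval_rpoly_def
  by (rule sum.mono_neutral_left) (use assms in \<open>auto simp: in_keys_iff\<close>)

lemma eval_rpoly_add: "eval_rpoly (p + q) x = eval_rpoly p x + eval_rpoly q x"
proof -
  let ?K = "Poly_Mapping.keys p \<union> Poly_Mapping.keys q"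
  have "finite ?K" "Poly_Mapping.keys (p + q) \<subseteq> ?K"
    by (auto simp: keys_add)
  then show ?thesis
    by (subst (1 2 3) eval_rpoly_eq_sum_superset[where K = ?K])
      (auto simp: lookup_add algebra_simps sum.distrib)
qed

lemma eval_rpoly_single:
  "eval_rpoly (Poly_Mapping.single m a) x = a * (\<Prod>i\<in>UNIV. (x $ i) ^ Poly_Mapping.lookup m i)"
  by (subst eval_rpoly_eq_sum_superset[where K = "{m}"]) auto

lemma polyfuns_monomial:
  assumes "(\<Sum>i\<in>UNIV. k i) \<le> d"
  shows "(\<lambda>x::real ^ 'v::finite. a * (\<Prod>i\<in>UNIV. (x $ i) ^ k i)) \<in> polyfuns d"
proof -
  \<comment> \<open>The inverse law requires finite support, which is automatic for a finite index
    type.\<close>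
  have k: "Poly_Mapping.lookup (Abs_poly_mapping k) = k"
    by (simp add: Abs_poly_mapping_inverse)
  have "total_degree (Poly_Mapping.single (Abs_poly_mapping k) a) \<le> d"
    using assms by (simp add: total_degree_le_iff monom_degree_eq_sum_UNIV k)
  moreover have "(\<lambda>x. a * (\<Prod>i\<in>UNIV. (x $ i) ^ k i)) =
      eval_rpoly (Poly_Mapping.single (Abs_poly_mapping k) a)"
    by (auto simp: eval_rpoly_single k)
  ultimately show ?thesis
    unfolding polyfuns_def by blast
qed

lemma polyfuns_const: "(\<lambda>x. a) \<in> polyfuns d"
  using polyfuns_monomial[of "\<lambda>i. 0" d a] by simp

lemma polyfuns_coordinate:
  fixes j :: "'v::finite"
  shows "(\<lambda>x. x $ j) \<in> polyfuns 1"
proof -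
  have "(\<Prod>i\<in>UNIV. (x $ i) ^ (if i = j then 1 else 0)) = x $ j" for x :: "real ^ 'v"
    by (subst prod.mono_neutral_cong_right[where S = "{j}" and h = "\<lambda>i. x $ i"]) auto
  with polyfuns_monomial[of "\<lambda>i. if i = j then 1 else 0" 1 1] show ?thesis
    by simp
qed

lemma polyfuns_add:
  assumes "F \<in> polyfuns d" "G \<in> polyfuns d"
  shows "(\<lambda>x. F x + G x) \<in> polyfuns d"
proof -
  obtain p q where "total_degree p \<le> d" "F = eval_rpoly p" "total_degree q \<le> d" "G = eval_rpoly q"
    using assms by (auto simp: polyfuns_def)
  moreover from this have "total_degree (p + q) \<le> d"
    using keys_add[of p q] by (auto simp: total_degree_le_iff)
  ultimately show ?thesis
    unfolding polyfuns_def by (auto simp: eval_rpoly_add fun_eq_iff intro!: exI[of _ "p + q"])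
qed

lemma polyfuns_sum:
  assumes "\<And>i. i \<in> I \<Longrightarrow> F i \<in> polyfuns d"
  shows "(\<lambda>x. \<Sum>i\<in>I. F i x) \<in> polyfuns d"
  using assms by (induction I rule: infinite_finite_induct) (auto intro: polyfuns_const polyfuns_add)

lemma polyfuns_mult:
  assumes "F \<in> polyfuns d" "G \<in> polyfuns e"
  shows "(\<lambda>x. F x * G x) \<in> polyfuns (d + e)"
proof -
  obtain p q where p: "total_degree p \<le> d" "F = eval_rpoly p"
    and q: "total_degree q \<le> e" "G = eval_rpoly q"
    using assms by (auto simp: polyfuns_def)
  have eq: "F x * G x = (\<Sum>m\<in>Poly_Mapping.keys p. \<Sum>l\<in>Poly_Mapping.keys q.
      (Poly_Mapping.lookup p m * Poly_Mapping.lookup q l) *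
      (\<Prod>i\<in>UNIV. (x $ i) ^ (Poly_Mapping.lookup m i + Poly_Mapping.lookup l i)))" for x
    by (simp add: p q eval_rpoly_def sum_product power_add prod.distrib algebra_simps)
  show ?thesis
    unfolding eq
    by (intro polyfuns_sum polyfuns_monomial)
      (use p(1) q(1) in \<open>auto simp: sum.distrib total_degree_le_iff monom_degree_eq_sum_UNIV
        intro!: add_mono\<close>)
qed

lemma polyfuns_cmult: "F \<in> polyfuns d \<Longrightarrow> (\<lambda>x. a * F x) \<in> polyfuns d"
  using polyfuns_mult[OF polyfuns_const[of a 0]] by simp

lemma polyfuns_mono: "d \<le> e \<Longrightarrow> F \<in> polyfuns d \<Longrightarrow> F \<in> polyfuns e"
  unfolding polyfuns_def using le_trans by blast

lemma polyfuns_eval_rpoly: "total_degree p \<le> d \<Longrightarrow> eval_rpoly p \<in> polyfuns d"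
  by (auto simp: polyfuns_def)

lemma sum_UNIV_Plus:
  fixes F :: "'a::finite + 'b::finite \<Rightarrow> 'c::comm_monoid_add"
  shows "(\<Sum>i\<in>UNIV. F i) = (\<Sum>i\<in>UNIV. F (Inl i)) + (\<Sum>i\<in>UNIV. F (Inr i))"
  by (simp add: UNIV_Plus_UNIV[symmetric] sum.Plus del: UNIV_Plus_UNIV)

lemma prod_UNIV_Plus:
  fixes F :: "'a::finite + 'b::finite \<Rightarrow> 'c::comm_monoid_mult"
  shows "(\<Prod>i\<in>UNIV. F i) = (\<Prod>i\<in>UNIV. F (Inl i)) * (\<Prod>i\<in>UNIV. F (Inr i))"
  by (simp add: UNIV_Plus_UNIV[symmetric] prod.Plus del: UNIV_Plus_UNIV)

text \<open>Fixing \<open>y\<close> turns the \<open>Inr\<close> part of each monomial into a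
  coefficient; the remaining \<open>Inl\<close> exponents sum to at most the original
  degree.\<close>

lemma polyfuns_section_left:
  assumes "F \<in> polyfuns d"
  shows "(\<lambda>x. F (vec_append x y)) \<in> polyfuns d"
proof -
  obtain p where p: "total_degree p \<le> d" "F = eval_rpoly p"
    using assms by (auto simp: polyfuns_def)
  have eq: "F (vec_append x y) = (\<Sum>m\<in>Poly_Mapping.keys p.
      (Poly_Mapping.lookup p m * (\<Prod>i\<in>UNIV. (y $ i) ^ Poly_Mapping.lookup m (Inr i))) *
      (\<Prod>i\<in>UNIV. (x $ i) ^ Poly_Mapping.lookup m (Inl i)))" for x
    unfolding p(2) eval_rpoly_def
    by (simp add: vec_append_def prod_UNIV_Plus mult_ac)
  show ?thesis
    unfolding eq
    by (intro polyfuns_sum polyfuns_monomial)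
      (use p(1) in \<open>force simp: total_degree_le_iff monom_degree_eq_sum_UNIV sum_UNIV_Plus\<close>)
qed

lemma polyfuns_section_right:
  assumes "F \<in> polyfuns d"
  shows "(\<lambda>y. F (vec_append x y)) \<in> polyfuns d"
proof -
  obtain p where p: "total_degree p \<le> d" "F = eval_rpoly p"
    using assms by (auto simp: polyfuns_def)
  have eq: "F (vec_append x y) = (\<Sum>m\<in>Poly_Mapping.keys p.
      (Poly_Mapping.lookup p m * (\<Prod>i\<in>UNIV. (x $ i) ^ Poly_Mapping.lookup m (Inl i))) *
      (\<Prod>i\<in>UNIV. (y $ i) ^ Poly_Mapping.lookup m (Inr i)))" for y
    unfolding p(2) eval_rpoly_def
    by (simp add: vec_append_def prod_UNIV_Plus mult_ac)
  show ?thesis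
    unfolding eq
    by (intro polyfuns_sum polyfuns_monomial)
      (use p(1) in \<open>force simp: total_degree_le_iff monom_degree_eq_sum_UNIV sum_UNIV_Plus\<close>)
qed

lemma polyfuns_prod:
  assumes "finite I" "\<And>i. i \<in> I \<Longrightarrow> F i \<in> polyfuns d"
  shows "(\<lambda>x. \<Prod>i\<in>I. F i x) \<in> polyfuns (card I * d)"
  using assms
  by (induction I rule: finite_induct) (auto intro: polyfuns_const polyfuns_mult)

section \<open>Interpolation and attainment of the threshold degree\<close>

text \<open>Lagrange-style interpolation: \<open>D u\<close> is the squared distance to
  \<open>u\<close>, so the product over \<open>Z - {w}\<close> vanishes on \<open>Z\<close> except
  at \<open>w\<close>. Weighted by \<open>h w\<close>, these products sum at each \<open>z\<close>
  in \<open>Z\<close> to a positive multiple of \<open>h z\<close>. This makes the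
  \<open>LEAST\<close> in the threshold degree attained.\<close>

lemma sign_representation_exists:
  fixes Z :: "(real ^ 'v::finite) set"
  assumes "finite Z" "\<And>z. z \<in> Z \<Longrightarrow> h z \<noteq> 0"
  shows "\<exists>p. \<forall>z\<in>Z. h z * eval_rpoly p z > 0"
proof -
  define D where "D u z = (\<Sum>i\<in>UNIV. (z $ i + - (u $ i)) * (z $ i + - (u $ i)))"
    for u z :: "real ^ 'v"
  have D: "D u \<in> polyfuns (1 + 1)" for u
    unfolding D_def by (intro polyfuns_sum polyfuns_mult polyfuns_add polyfuns_coordinate polyfuns_const)
  have D0: "D u u = 0" for u
    by (simp add: D_def)
  have Dpos: "D u z > 0" if uz: "u \<noteq> z" for u z
  proof -
    obtain i where "u $ i \<noteq> z $ i"
      using uz unfolding vec_eq_iff by blast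
    then show ?thesis
      unfolding D_def by (intro sum_pos2[where i = i]) (auto simp: zero_less_mult_iff)
  qed
  define P where "P z = (\<Sum>w\<in>Z. h w * (\<Prod>u\<in>Z - {w}. D u z))" for z
  have "(\<lambda>z. h w * (\<Prod>u\<in>Z - {w}. D u z)) \<in> polyfuns (card Z * 2)" if "w \<in> Z" for w
  proof (rule polyfuns_cmult[OF polyfuns_mono])
    show "(\<lambda>z. \<Prod>u\<in>Z - {w}. D u z) \<in> polyfuns (card (Z - {w}) * (1 + 1))"
      using assms(1) D by (intro polyfuns_prod) auto
    show "card (Z - {w}) * (1 + 1) \<le> card Z * 2"
      using card_mono[OF assms(1), of "Z - {w}"] by auto
  qed
  then have "P \<in> polyfuns (card Z * 2)"
    unfolding P_def by (intro polyfuns_sum) auto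
  then obtain p where p: "P = eval_rpoly p"
    by (auto simp: polyfuns_def)
  have "h z * P z > 0" if z: "z \<in> Z" for z
  proof -
    have "(\<Prod>u\<in>Z - {w}. D u z) = 0" if "w \<in> Z - {z}" for w
      using z that assms(1) D0 by (intro prod_zero) auto
    then have "(\<Sum>w\<in>Z - {z}. h w * (\<Prod>u\<in>Z - {w}. D u z)) = 0"
      by (simp add: sum.neutral del: prod_zero_iff)
    then have "P z = h z * (\<Prod>u\<in>Z - {z}. D u z)"
      unfolding P_def using assms(1) z by (subst sum.remove[of _ z]) simp_all
    moreover have "(\<Prod>u\<in>Z - {z}. D u z) > 0"
      using Dpos by (intro prod_pos) auto
    ultimately show ?thesis
      using assms(2)[OF z] by (auto simp: zero_less_mult_iff mult_less_0_iff)
  qed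
  with p show ?thesis
    by auto
qed

lemma threshold_degree_attained:
  assumes "finite Z" "\<And>z. z \<in> Z \<Longrightarrow> h z \<noteq> 0"
  obtains p where "total_degree p = threshold_degree Z h" "\<And>z. z \<in> Z \<Longrightarrow> h z * eval_rpoly p z > 0"
proof -
  have "\<exists>d p. total_degree p = d \<and> (\<forall>z\<in>Z. h z * eval_rpoly p z > 0)"
    using sign_representation_exists[of Z h] assms by blast
  from LeastI_ex[OF this] show ?thesis
    unfolding threshold_degree_def[symmetric] using that by blast
qed

section \<open>Gordan's theorem of the alternative\<close>

text \<open>Induction on \<open>A\<close>. Adding \<open>a\<close> shrinks the cone to its members
  negative at \<open>a\<close>. If there are none, the indicator of \<open>a\<close> is a dual
  vector. Otherwise a dual vector for the smaller cone is extended by a weight \<open>t\<close> at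
  \<open>a\<close>, chosen so that the form is nonnegative on all of \<open>C\<close>.\<close>

lemma convex_cone_alternative:
  fixes C :: "('a \<Rightarrow> real) set"
  assumes "finite A"
    and add: "\<And>u v. u \<in> C \<Longrightarrow> v \<in> C \<Longrightarrow> (\<lambda>x. u x + v x) \<in> C"
    and scale: "\<And>u a. u \<in> C \<Longrightarrow> 0 < a \<Longrightarrow> (\<lambda>x. a * u x) \<in> C"
    and "C \<noteq> {}"
  shows "(\<exists>v\<in>C. \<forall>x\<in>A. v x < 0) \<or>
    (\<exists>z. (\<forall>x\<in>A. 0 \<le> z x) \<and> (\<exists>x\<in>A. 0 < z x) \<and> (\<forall>v\<in>C. 0 \<le> (\<Sum>x\<in>A. z x * v x)))"
  using assms
proof (induction A arbitrary: C rule: finite_induct)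
  case empty
  then show ?case by auto
next
  case (insert a A)
  let ?C = "{v \<in> C. v a < 0}"
  show ?case
  proof (cases "?C = {}")
    case True
    then have "\<forall>v\<in>C. 0 \<le> v a"
      by force
    moreover have "(\<Sum>x\<in>A. (if x = a then 1 else 0) * v x) = 0" for v :: "'a \<Rightarrow> real"
      using insert.hyps by (intro sum.neutral) auto
    ultimately show ?thesis
      using insert.hyps by (intro disjI2 exI[of _ "\<lambda>x. if x = a then 1 else 0"]) auto
  next
    case False
    have "(\<exists>v\<in>?C. \<forall>x\<in>A. v x < 0) \<or>
      (\<exists>z. (\<forall>x\<in>A. 0 \<le> z x) \<and> (\<exists>x\<in>A. 0 < z x) \<and> (\<forall>v\<in>?C. 0 \<le> (\<Sum>x\<in>A. z x * v x)))"
      using False insert.prems by (intro insert.IH) (auto simp: mult_pos_neg)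
    then show ?thesis
    proof
      assume "\<exists>v\<in>?C. \<forall>x\<in>A. v x < 0"
      then show ?thesis by auto
    next
      assume "\<exists>z. (\<forall>x\<in>A. 0 \<le> z x) \<and> (\<exists>x\<in>A. 0 < z x) \<and> (\<forall>v\<in>?C. 0 \<le> (\<Sum>x\<in>A. z x * v x))"
      then obtain z where z: "\<And>x. x \<in> A \<Longrightarrow> 0 \<le> z x" "\<exists>x\<in>A. 0 < z x"
        and zC: "\<And>v. v \<in> ?C \<Longrightarrow> 0 \<le> (\<Sum>x\<in>A. z x * v x)"
        by blast
      define S where "S v = (\<Sum>x\<in>A. z x * v x)" for v
      \<comment> \<open>The largest weight of \<open>a\<close> that keeps the form nonnegative on \<open>?C\<close>.\<close>
      define t where "t = (INF v\<in>?C. S v / (- v a))"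
      have nonneg: "0 \<le> S v / (- v a)" if "v \<in> ?C" for v
        using zC[OF that] that by (auto simp: S_def divide_nonneg_neg)
      have bdd: "bdd_below ((\<lambda>v. S v / (- v a)) ` ?C)"
        using nonneg by (intro bdd_belowI[of _ 0]) blast
      have t0: "0 \<le> t"
        unfolding t_def using False nonneg by (intro cINF_greatest) auto
      have neg: "0 \<le> S v + t * v a" if "v \<in> ?C" for v
      proof -
        have "t \<le> S v / (- v a)"
          unfolding t_def using bdd that by (rule cINF_lower)
        moreover have "- v a > 0"
          using that by simp
        ultimately have "t * (- v a) \<le> S v"
          by (simp only: pos_le_divide_eq)
        then show ?thesis by simp
      qed
      have pos: "0 \<le> S v + t * v a" if v: "v \<in> C" "0 \<le> v a" for v
      proof (rule field_le_epsilon)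
        fix e :: real assume "0 < e"
        then have "t < t + e / (v a + 1)"
          using v by simp
        then obtain u where u: "u \<in> ?C" "S u / (- u a) < t + e / (v a + 1)"
          unfolding t_def using cINF_less_iff[OF False bdd] by blast
        \<comment> \<open>The infimum \<open>t\<close> need not be attained, so \<open>u\<close> is
          only near-optimal. The factor \<open>r\<close> gives \<open>v + r * u\<close> the value -1
          at \<open>a\<close>, which puts it into \<open>?C\<close>; the slack
          \<open>e / (v a + 1)\<close> in the choice of \<open>u\<close> becomes exactly
          \<open>e\<close> after scaling.\<close>
        define r where "r = (v a + 1) / (- u a)"
        have r: "0 < r" "r * u a = - (v a + 1)"
          using u v by (auto simp: r_def divide_neg_neg field_simps)
        have "(\<lambda>x. v x + r * u x) \<in> ?C"
          using u v r insert.prems(1,2) by auto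
        from neg[OF this] have "0 \<le> S (\<lambda>x. v x + r * u x) + t * (v a + r * u a)" .
        moreover have "S (\<lambda>x. v x + r * u x) = S v + r * S u"
          by (simp add: S_def sum.distrib sum_distrib_left algebra_simps)
        ultimately have "0 \<le> S v + r * S u - t"
          using r by simp
        moreover have "r * S u = (v a + 1) * (S u / (- u a))"
          by (simp add: r_def)
        moreover have "(v a + 1) * (S u / (- u a)) \<le> (v a + 1) * (t + e / (v a + 1))"
          using u v by (intro mult_left_mono) auto
        moreover have "(v a + 1) * (t + e / (v a + 1)) = t * v a + t + e"
          using v by (simp add: field_simps)
        ultimately show "0 \<le> S v + t * v a + e"
          by simp
      qed
      define z' where "z' = z(a := t)"
      have S': "(\<Sum>x\<in>A. z' x * v x) = S v" for v
        unfolding S_def z'_def using insert.hyps by (intro sum.cong) auto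
      have "0 \<le> (\<Sum>x\<in>insert a A. z' x * v x)" if "v \<in> C" for v
      proof -
        have "(\<Sum>x\<in>insert a A. z' x * v x) = S v + t * v a"
          using insert.hyps S'[of v] by (simp add: z'_def)
        then show ?thesis
          using neg[of v] pos[of v] that by (cases "v a < 0") auto
      qed
      moreover have "\<forall>x\<in>insert a A. 0 \<le> z' x" "\<exists>x\<in>insert a A. 0 < z' x"
        using z t0 insert.hyps by (auto simp: z'_def)
      ultimately show ?thesis
        by blast
    qed
  qed
qed

text \<open>The cone alternative applied to all nonnegative combinations of the columns of
  \<open>M\<close>. Each column lies in this cone, which yields the dual inequalities.\<close>

lemma gordan_alternative:
  fixes M :: "'a \<Rightarrow> 'b \<Rightarrow> real"
  assumes "finite A" "finite B"
  shows "(\<exists>w. (\<forall>y\<in>B. 0 \<le> w y) \<and> (\<forall>x\<in>A. (\<Sum>y\<in>B. w y * M x y) < 0)) \<or>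
    (\<exists>z. (\<forall>x\<in>A. 0 \<le> z x) \<and> (\<exists>x\<in>A. 0 < z x) \<and> (\<forall>y\<in>B. 0 \<le> (\<Sum>x\<in>A. z x * M x y)))"
proof -
  define C where "C = {v. \<exists>w. (\<forall>y\<in>B. 0 \<le> w y) \<and> v = (\<lambda>x. \<Sum>y\<in>B. w y * M x y)}"
  have "(\<lambda>x. u x + v x) \<in> C" if uv: "u \<in> C" "v \<in> C" for u v
  proof -
    obtain w w' where "\<forall>y\<in>B. 0 \<le> w y" "u = (\<lambda>x. \<Sum>y\<in>B. w y * M x y)"
      "\<forall>y\<in>B. 0 \<le> w' y" "v = (\<lambda>x. \<Sum>y\<in>B. w' y * M x y)"
      using uv by (auto simp: C_def)
    then show ?thesis
      unfolding C_def
      by (auto intro!: exI[of _ "\<lambda>y. w y + w' y"] simp: sum.distrib distrib_right)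
  qed
  moreover have "(\<lambda>x. a * u x) \<in> C" if u: "u \<in> C" "0 < a" for u a
  proof -
    obtain w where "\<forall>y\<in>B. 0 \<le> w y" "u = (\<lambda>x. \<Sum>y\<in>B. w y * M x y)"
      using u by (auto simp: C_def)
    with u show ?thesis
      unfolding C_def
      by (auto intro!: exI[of _ "\<lambda>y. a * w y"] simp: sum_distrib_left mult.assoc)
  qed
  moreover have gen: "(\<lambda>x. M x y) \<in> C" if "y \<in> B" for y
    unfolding C_def using that assms(2)
    by (auto intro!: exI[of _ "\<lambda>y'. if y' = y then 1 else 0"] simp: if_distrib[of "\<lambda>a. a * _"] cong: if_cong)
  moreover have "(\<lambda>x. 0) \<in> C"
    unfolding C_def by (auto intro!: exI[of _ "\<lambda>y'. 0"])
  ultimately have "(\<exists>v\<in>C. \<forall>x\<in>A. v x < 0) \<or>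
    (\<exists>z. (\<forall>x\<in>A. 0 \<le> z x) \<and> (\<exists>x\<in>A. 0 < z x) \<and> (\<forall>v\<in>C. 0 \<le> (\<Sum>x\<in>A. z x * v x)))"
    using assms(1) by (intro convex_cone_alternative) auto
  then show ?thesis
  proof
    assume "\<exists>v\<in>C. \<forall>x\<in>A. v x < 0"
    then show ?thesis unfolding C_def by blast
  next
    assume "\<exists>z. (\<forall>x\<in>A. 0 \<le> z x) \<and> (\<exists>x\<in>A. 0 < z x) \<and> (\<forall>v\<in>C. 0 \<le> (\<Sum>x\<in>A. z x * v x))"
    then obtain z where z: "\<forall>x\<in>A. 0 \<le> z x" "\<exists>x\<in>A. 0 < z x"
      "\<forall>v\<in>C. 0 \<le> (\<Sum>x\<in>A. z x * v x)"
      by blast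
    then have "\<forall>y\<in>B. 0 \<le> (\<Sum>x\<in>A. z x * M x y)"
      using bspec[OF z(3) gen] by blast
    with z(1,2) show ?thesis
      by blast
  qed
qed

section \<open>Separation by quotients of sections\<close>

text \<open>The sign of \<open>q\<close> is left free on purpose: of the two branches of
  \<open>separates_alternative\<close>, one produces a positive denominator, the other a positive
  numerator with a denominator of varying sign. Fixing the bound -1 on \<open>F\<close> removes the
  scaling freedom, so \<open>c\<close> is the only parameter.\<close>

definition separates :: "nat \<Rightarrow> (real ^ 'v::finite) set \<Rightarrow> (real ^ 'v) set \<Rightarrow> real \<Rightarrow> bool" where
  "separates d T F c \<longleftrightarrow> (\<exists>p\<in>polyfuns d. \<exists>q\<in>polyfuns d.
     (\<forall>x\<in>T. q x \<noteq> 0 \<and> 0 < p x / q x \<and> p x / q x \<le> c) \<and>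
     (\<forall>x\<in>F. q x \<noteq> 0 \<and> p x / q x \<le> -1))"

definition ratapprox :: "nat \<Rightarrow> (real ^ 'v::finite) set \<Rightarrow> (real ^ 'v \<Rightarrow> real) \<Rightarrow> real \<Rightarrow> bool" where
  "ratapprox d X f e \<longleftrightarrow> (\<exists>p\<in>polyfuns d. \<exists>q\<in>polyfuns d.
     \<forall>x\<in>X. q x \<noteq> 0 \<and> \<bar>f x - p x / q x\<bar> \<le> e)"

lemma separatesI:
  assumes "p \<in> polyfuns d" "q \<in> polyfuns d"
    and "\<And>x. x \<in> T \<Longrightarrow> q x \<noteq> 0 \<and> 0 < p x / q x \<and> p x / q x \<le> c"
    and "\<And>x. x \<in> F \<Longrightarrow> q x \<noteq> 0 \<and> p x / q x \<le> -1"
  shows "separates d T F c"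
  unfolding separates_def
  by (rule bexI[OF bexI[OF _ assms(2)] assms(1)]) (use assms(3,4) in blast)

lemma ratapproxI:
  assumes "p \<in> polyfuns d" "q \<in> polyfuns d"
    and "\<And>x. x \<in> X \<Longrightarrow> q x \<noteq> 0 \<and> \<bar>f x - p x / q x\<bar> \<le> e"
  shows "ratapprox d X f e"
  unfolding ratapprox_def
  by (rule bexI[OF bexI[OF _ assms(2)] assms(1)]) (use assms(3) in blast)

lemma separates_mono: "separates d T F c \<Longrightarrow> c \<le> c' \<Longrightarrow> separates d T F c'"
  unfolding separates_def by (blast intro: order_trans)

lemma ratapprox_mono: "ratapprox d X f e \<Longrightarrow> d \<le> d' \<Longrightarrow> ratapprox d' X f e"
  unfolding ratapprox_def by (meson polyfuns_mono)

text \<open>Supplies some finite level to start from, with \<open>u\<close> and \<open>v\<close> the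
  sections at a true and at a false point of the other function. Scaling \<open>v\<close> by the
  least ratio \<open>r\<close> on \<open>F\<close> enforces the bound -1 there; \<open>c\<close> is
  then the largest quotient on \<open>T\<close>.\<close>

lemma separates_of_sign_pattern:
  fixes T F :: "(real ^ 'v::finite) set"
  assumes "finite T" "finite F" "T \<noteq> {}" "F \<noteq> {}"
    and "u \<in> polyfuns d" "v \<in> polyfuns d"
    and T: "\<And>x. x \<in> T \<Longrightarrow> 0 < u x \<and> v x < 0"
    and F: "\<And>x. x \<in> F \<Longrightarrow> u x < 0 \<and> v x < 0"
  shows "\<exists>c>0. separates d T F c"
proof -
  define r where "r = Min ((\<lambda>x. u x / v x) ` F)"
  have r: "0 < r" "\<And>x. x \<in> F \<Longrightarrow> r \<le> u x / v x"
    using assms F by (auto simp: r_def divide_neg_neg)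
  define c where "c = Max ((\<lambda>x. u x / (- r * v x)) ` T)"
  have quot: "0 < u x / (- r * v x)" if "x \<in> T" for x
    using T[OF that] r by (intro divide_pos_pos) (auto simp: mult_pos_neg)
  have c: "u x / (- r * v x) \<le> c" if "x \<in> T" for x
    unfolding c_def using that assms by (intro Max_ge) auto
  have "u x / (- r * v x) \<le> -1" if "x \<in> F" for x
  proof -
    have "u x / (- r * v x) = - ((u x / v x) / r)"
      by simp
    moreover have "1 \<le> (u x / v x) / r"
      using r(1) r(2)[OF that] by (simp only: pos_le_divide_eq mult_1_left)
    ultimately show ?thesis
      by linarith
  qed
  moreover have "r * v x \<noteq> 0" if "x \<in> T \<union> F" for x
    using r(1) T F that by force
  moreover have "(\<lambda>x. - r * v x) \<in> polyfuns d"
    using assms by (intro polyfuns_cmult)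
  ultimately have "separates d T F c"
    using quot c assms(5) by (intro separatesI[of u d "\<lambda>x. - r * v x"]) auto
  moreover have "0 < c"
    using quot c \<open>T \<noteq> {}\<close> by (meson all_not_in_conv less_le_trans)
  ultimately show ?thesis by blast
qed

lemma weighted_sum_pos:
  fixes w :: "'a \<Rightarrow> real"
  assumes "finite B" "\<And>y. y \<in> B \<Longrightarrow> 0 \<le> w y" "\<And>y. y \<in> B \<Longrightarrow> 0 < h y" "\<exists>y\<in>B. 0 < w y"
  shows "0 < (\<Sum>y\<in>B. w y * h y)"
proof -
  obtain b where "b \<in> B" "0 < w b"
    using assms by blast
  then show ?thesis
    using assms by (intro sum_pos2[of _ b]) (auto simp: less_imp_le)
qed

lemma weight_pos_of_weighted_sum_nonzero:
  fixes w :: "'a \<Rightarrow> real"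
  assumes "(\<Sum>y\<in>B. w y * h y) \<noteq> 0" "\<And>y. y \<in> B \<Longrightarrow> 0 \<le> w y"
  shows "\<exists>y\<in>B. 0 < w y"
proof (rule ccontr)
  assume "\<not> (\<exists>y\<in>B. 0 < w y)"
  then have "\<forall>y\<in>B. w y = 0"
    using assms(2) by force
  then show False
    using assms(1) by simp
qed

lemma separates_alternative:
  fixes T F :: "(real ^ 'n::finite) set" and T' F' :: "(real ^ 'm::finite) set"
    and \<phi> :: "real ^ 'n \<Rightarrow> real ^ 'm \<Rightarrow> real"
  assumes fin: "finite T" "finite F" "finite T'" "finite F'"
    and ne: "T \<noteq> {}" "F \<noteq> {}" "T' \<noteq> {}" "F' \<noteq> {}"
    and disj: "T \<inter> F = {}" "T' \<inter> F' = {}"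
    and deg: "\<And>x. \<phi> x \<in> polyfuns d" "\<And>y. (\<lambda>x. \<phi> x y) \<in> polyfuns d"
    and TT: "\<And>x y. x \<in> T \<Longrightarrow> y \<in> T' \<Longrightarrow> 0 < \<phi> x y"
    and TF: "\<And>x y. x \<in> T \<Longrightarrow> y \<in> F' \<Longrightarrow> \<phi> x y < 0"
    and FY: "\<And>x y. x \<in> F \<Longrightarrow> y \<in> T' \<union> F' \<Longrightarrow> \<phi> x y < 0"
    and c: "0 < c"
  shows "separates d T F c \<or> separates d T' F' (1 / c)"
proof -
  \<comment> \<open>With weights \<open>w\<close> on the columns, row \<open>x\<close> reads
    \<open>p x < c * q x\<close> on \<open>T\<close> and \<open>p x < - q x\<close> on
    \<open>F\<close>. With weights \<open>z\<close> on the rows, column \<open>y\<close> reads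
    \<open>p y \<le> q y\<close> on \<open>T'\<close> and \<open>0 \<le> c * q y + p y\<close> on
    \<open>F'\<close>, for the \<open>p\<close> and \<open>q\<close> of the respective
    branch.\<close>
  define M where "M x y = (if y \<in> T' then 1 else if x \<in> T then c else -1) * \<phi> x y" for x y
  have split: "(\<Sum>y\<in>T' \<union> F'. h y) = (\<Sum>y\<in>T'. h y) + (\<Sum>y\<in>F'. h y)"
    "(\<Sum>x\<in>T \<union> F. k x) = (\<Sum>x\<in>T. k x) + (\<Sum>x\<in>F. k x)" for h k :: "_ \<Rightarrow> real"
    using fin disj by (simp_all add: sum.union_disjoint)
  have "(\<exists>w. (\<forall>y\<in>T' \<union> F'. 0 \<le> w y) \<and> (\<forall>x\<in>T \<union> F. (\<Sum>y\<in>T' \<union> F'. w y * M x y) < 0)) \<or>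
    (\<exists>z. (\<forall>x\<in>T \<union> F. 0 \<le> z x) \<and> (\<exists>x\<in>T \<union> F. 0 < z x) \<and>
      (\<forall>y\<in>T' \<union> F'. 0 \<le> (\<Sum>x\<in>T \<union> F. z x * M x y)))"
    using fin by (intro gordan_alternative) auto
  then show ?thesis
  proof (elim disjE exE conjE)
    fix w assume w: "\<forall>y\<in>T' \<union> F'. 0 \<le> w y" "\<forall>x\<in>T \<union> F. (\<Sum>y\<in>T' \<union> F'. w y * M x y) < 0"
    define p where "p x = (\<Sum>y\<in>T'. w y * \<phi> x y)" for x
    define q where "q x = (\<Sum>y\<in>F'. w y * - \<phi> x y)" for x
    have sumM: "(\<Sum>y\<in>T' \<union> F'. w y * M x y) = p x + (if x \<in> T then - c else 1) * q x" for x
    proof -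
      have "(\<Sum>y\<in>T'. w y * M x y) = p x"
        unfolding p_def M_def by (intro sum.cong) auto
      moreover have "(\<Sum>y\<in>F'. w y * M x y) = (if x \<in> T then - c else 1) * q x"
        unfolding q_def M_def sum_distrib_left using disj by (intro sum.cong) auto
      ultimately show ?thesis
        by (simp add: split)
    qed
    have pT: "p x < c * q x" if "x \<in> T" for x
      using bspec[OF w(2), of x] sumM[of x] that by auto
    have pF: "p x < - q x" if "x \<in> F" for x
    proof -
      have "x \<notin> T"
        using that disj by auto
      then show ?thesis
        using bspec[OF w(2), of x] sumM[of x] that by auto
    qed
    \<comment> \<open>Strict positivity is bootstrapped: the row of \<open>t\<close> forces a
      positive weight on \<open>F'\<close>, hence \<open>q > 0\<close> everywhere; then the row of
      \<open>s\<close> forces a positive weight on \<open>T'\<close>.\<close>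
    obtain t s where ts: "t \<in> T" "s \<in> F"
      using ne by auto
    have "0 \<le> p t"
      unfolding p_def using w(1) ts TT by (intro sum_nonneg) (auto simp: less_imp_le)
    then have "q t \<noteq> 0"
      using pT[OF ts(1)] by auto
    then have exF': "\<exists>y\<in>F'. 0 < w y"
      using w(1) unfolding q_def by (elim weight_pos_of_weighted_sum_nonzero) auto
    have q: "0 < q x" if "x \<in> T \<union> F" for x
      unfolding q_def using fin w(1) exF' that TF FY by (intro weighted_sum_pos) auto
    have "p s \<noteq> 0"
      using pF[OF ts(2)] q[of s] ts by auto
    then have exT': "\<exists>y\<in>T'. 0 < w y"
      using w(1) unfolding p_def by (elim weight_pos_of_weighted_sum_nonzero) auto
    have p: "0 < p x" if "x \<in> T" for x
      unfolding p_def using fin w(1) exT' that TT by (intro weighted_sum_pos) auto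
    have "p \<in> polyfuns d"
      unfolding p_def using deg by (intro polyfuns_sum polyfuns_cmult) auto
    moreover have "q \<in> polyfuns d"
      using polyfuns_cmult[OF polyfuns_sum[of F' "\<lambda>y x. w y * \<phi> x y" d], of "-1"]
        polyfuns_cmult[OF deg(2)]
      by (simp add: q_def[abs_def] sum_negf)
    moreover have "q x \<noteq> 0 \<and> 0 < p x / q x \<and> p x / q x \<le> c" if "x \<in> T" for x
      using p[OF that] q[of x] pT[OF that] that by (auto simp: divide_simps)
    moreover have "q x \<noteq> 0 \<and> p x / q x \<le> -1" if "x \<in> F" for x
      using q[of x] pF[OF that] that by (auto simp: divide_simps)
    ultimately have "separates d T F c"
      by (rule separatesI)
    then show ?thesis ..
  next
    fix z assume z: "\<forall>x\<in>T \<union> F. 0 \<le> z x" "\<exists>x\<in>T \<union> F. 0 < z x"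
      "\<forall>y\<in>T' \<union> F'. 0 \<le> (\<Sum>x\<in>T \<union> F. z x * M x y)"
    \<comment> \<open>The roles are now swapped: \<open>p\<close> comes from the false rows and is
      positive throughout, while \<open>q\<close> comes from the true rows and changes sign. The
      quotient used is \<open>p / (c * q)\<close>.\<close>
    define p where "p y = (\<Sum>x\<in>F. z x * - \<phi> x y)" for y
    define q where "q y = (\<Sum>x\<in>T. z x * \<phi> x y)" for y
    have sumM: "(\<Sum>x\<in>T \<union> F. z x * M x y) = (if y \<in> T' then q y - p y else c * q y + p y)" for y
    proof -
      have "(\<Sum>x\<in>T. z x * M x y) = (if y \<in> T' then 1 else c) * q y"
        unfolding q_def M_def sum_distrib_left by (intro sum.cong) auto
      moreover have "(\<Sum>x\<in>F. z x * M x y) = (if y \<in> T' then -1 else 1) * p y"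
        unfolding p_def M_def sum_distrib_left using disj by (intro sum.cong) auto
      ultimately show ?thesis
        by (simp add: split)
    qed
    have T': "p y \<le> q y" if "y \<in> T'" for y
      using bspec[OF z(3), of y] sumM[of y] that by auto
    have F': "0 \<le> c * q y + p y" if "y \<in> F'" for y
    proof -
      have "y \<notin> T'"
        using that disj by auto
      then show ?thesis
        using bspec[OF z(3), of y] sumM[of y] that by auto
    qed
    \<comment> \<open>The alternative provides a positive weight only somewhere in
      \<open>T \<union> F\<close>. If all weights on one side vanished, the columns over
      \<open>T'\<close> (for \<open>T\<close>) or over \<open>F'\<close> (for \<open>F\<close>)
      would be violated.\<close>
    have exT: "\<exists>x\<in>T. 0 < z x"
    proof (rule ccontr)
      assume neg: "\<not> (\<exists>x\<in>T. 0 < z x)"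
      then have "q y = 0" for y
        using weight_pos_of_weighted_sum_nonzero[of z "\<lambda>x. \<phi> x y" T] z(1) unfolding q_def by auto
      moreover obtain t where "t \<in> T'"
        using ne by auto
      moreover have "0 < p t"
        unfolding p_def using fin z neg \<open>t \<in> T'\<close> FY by (intro weighted_sum_pos) auto
      ultimately show False
        using T'[of t] by auto
    qed
    have qT: "0 < q y" if "y \<in> T'" for y
      unfolding q_def using fin z(1) exT that TT by (intro weighted_sum_pos) auto
    have "0 < (\<Sum>x\<in>T. z x * - \<phi> x y)" if "y \<in> F'" for y
      using fin z(1) exT that TF by (intro weighted_sum_pos) auto
    then have qF: "q y < 0" if "y \<in> F'" for y
      using that by (simp add: q_def sum_negf)
    have exF: "\<exists>x\<in>F. 0 < z x"
    proof (rule ccontr)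
      assume neg: "\<not> (\<exists>x\<in>F. 0 < z x)"
      then have "p y = 0" for y
        using weight_pos_of_weighted_sum_nonzero[of z "\<lambda>x. - \<phi> x y" F] z(1) unfolding p_def by auto
      moreover obtain s where "s \<in> F'"
        using ne by auto
      ultimately show False
        using F'[of s] qF[of s] c by (auto simp: zero_le_mult_iff)
    qed
    have p: "0 < p y" if "y \<in> T' \<union> F'" for y
      unfolding p_def using fin z(1) exF that FY by (intro weighted_sum_pos) auto
    have "q \<in> polyfuns d"
      unfolding q_def using deg by (intro polyfuns_sum polyfuns_cmult) auto
    then have cq: "(\<lambda>y. c * q y) \<in> polyfuns d"
      by (rule polyfuns_cmult)
    have "p \<in> polyfuns d"
      using polyfuns_cmult[OF polyfuns_sum[of F "\<lambda>x y. z x * \<phi> x y" d], of "-1"]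
        polyfuns_cmult[OF deg(1)]
      by (simp add: p_def[abs_def] sum_negf)
    moreover have "c * q y \<noteq> 0 \<and> 0 < p y / (c * q y) \<and> p y / (c * q y) \<le> 1 / c" if "y \<in> T'" for y
      using p[of y] qT[OF that] T'[OF that] that c by (auto simp: divide_simps)
    moreover have "c * q y \<noteq> 0 \<and> p y / (c * q y) \<le> -1" if "y \<in> F'" for y
    proof -
      have "c * q y < 0"
        using c qF[OF that] by (simp add: mult_pos_neg)
      then show ?thesis
        using F'[OF that] by (auto simp: neg_divide_le_eq)
    qed
    ultimately have "separates d T' F' (1 / c)"
      using cq by (intro separatesI[of p d "\<lambda>y. c * q y"])
    then show ?thesis ..
  qed
qed

text \<open>If no \<open>c\<close> worked, the alternative at \<open>c / 2\<close> would always fall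
  on the first side, so every level \<open>c0 / 2 ^ k\<close> would be reached. But
  \<open>2 / (c0 / 2 ^ k)\<close> eventually exceeds \<open>C\<close>, where the second side does
  hold. The factor 2 is the cost of moving in halving steps.\<close>

lemma separates_balanced:
  assumes c0: "0 < c0" "separates d T F c0" and C: "0 < C" "separates e T' F' C"
    and alt: "\<And>c. 0 < c \<Longrightarrow> separates d T F c \<or> separates e T' F' (1 / c)"
  obtains c where "0 < c" "separates d T F c" "separates e T' F' (2 / c)"
proof (rule ccontr)
  assume "\<not> thesis"
  then have no: "\<not> separates e T' F' (2 / c)" if "0 < c" "separates d T F c" for c
    using that \<open>\<And>c. \<lbrakk>0 < c; separates d T F c; separates e T' F' (2 / c)\<rbrakk> \<Longrightarrow> thesis\<close> by blast
  have all: "separates d T F (c0 / 2 ^ k)" for k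
  proof (induction k)
    case (Suc k)
    then show ?case
      using no[of "c0 / 2 ^ k"] alt[of "c0 / 2 ^ Suc k"] c0 by (auto simp: field_simps)
  qed (use c0 in simp)
  obtain k where "C * c0 / 2 < 2 ^ k"
    using real_arch_pow[of 2 "C * c0 / 2"] by auto
  then have "C \<le> 2 / (c0 / 2 ^ k)"
    using c0 by (simp add: field_simps)
  then show False
    using no[OF _ all[of k]] separates_mono[OF C(2)] c0 by simp
qed

section \<open>From separation to approximation\<close>

text \<open>On \<open>(0, c]\<close> and \<open>(-\<infinity>, -1]\<close> the optimal quadratic rational approximant of the sign is
  \<open>h(z) = (c + 2cz - z\<^sup>2) / (c + z\<^sup>2)\<close>. It is odd under the Moebius involution
  \<open>z \<mapsto> c(z + 1) / (z - c)\<close>, which exchanges the two intervals, and \<open>1 \<le> \<bar>h\<bar> \<le> \<surd>(1 + c)\<close> there.\<close>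

lemma quadratic_sign_approximant:
  fixes c z :: real
  assumes "0 < c"
  defines "A \<equiv> sqrt (1 + c)" and "h \<equiv> (c + 2 * c * z - z\<^sup>2) / (c + z\<^sup>2)"
  shows "0 < z \<Longrightarrow> z \<le> c \<Longrightarrow> 1 \<le> h \<and> h \<le> A"
    and "z \<le> -1 \<Longrightarrow> - A \<le> h \<and> h \<le> -1"
proof -
  have A: "1 < A" "A\<^sup>2 = 1 + c"
    using assms(1) by (auto simp: A_def)
  have D: "0 < c + z\<^sup>2"
    using assms(1) by (simp add: add_pos_nonneg)
  have c: "c = (A - 1) * (A + 1)"
    using A(2) by (simp add: algebra_simps power2_eq_square)
  \<comment> \<open>Writing \<open>c = (A - 1) * (A + 1)\<close> turns the numerators of
    \<open>A - h\<close> and \<open>A + h\<close> into multiples of squares, with double zeros at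
    \<open>A - 1\<close> and \<open>- (A + 1)\<close>. The bounds by 1 and -1 come from the
    numerators \<open>2 * z * (c - z)\<close> of \<open>h - 1\<close> and
    \<open>2 * c * (1 + z)\<close> of \<open>h + 1\<close>.\<close>
  have "0 \<le> (A + 1) * (z - (A - 1))\<^sup>2"
    using A by simp
  also have "\<dots> = A * (c + z\<^sup>2) - (c + 2 * c * z - z\<^sup>2)"
    unfolding c by (simp add: algebra_simps power2_eq_square)
  finally have upper: "h \<le> A"
    unfolding h_def using D by (simp add: pos_divide_le_eq)
  have "0 \<le> (A - 1) * (z + (A + 1))\<^sup>2"
    using A by simp
  also have "\<dots> = A * (c + z\<^sup>2) + (c + 2 * c * z - z\<^sup>2)"
    unfolding c by (simp add: algebra_simps power2_eq_square)
  finally have lower: "- A \<le> h"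
    unfolding h_def using D by (simp add: pos_le_divide_eq)
  {
    assume "0 < z" "z \<le> c"
    then have "0 \<le> 2 * (z * (c - z))"
      by simp
    then have "1 \<le> h"
      unfolding h_def using D by (simp add: pos_le_divide_eq algebra_simps power2_eq_square)
    with upper show "1 \<le> h \<and> h \<le> A" by simp
  next
    assume "z \<le> -1"
    then have "2 * (c * (1 + z)) \<le> 0"
      using assms(1) by (simp add: mult_nonneg_nonpos)
    then have "h \<le> -1"
      unfolding h_def using D by (simp add: pos_divide_le_eq algebra_simps)
    with lower show "- A \<le> h \<and> h \<le> -1" by simp
  }
qed

text \<open>The factor \<open>2 / (A + 1)\<close> moves the midpoint of \<open>[1, A]\<close> to 1,
  which balances the errors at the two ends.\<close>

lemma rescaled_error:
  fixes A h :: real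
  assumes "1 \<le> h" "h \<le> A"
  shows "\<bar>1 - 2 / (A + 1) * h\<bar> \<le> (A - 1) / (A + 1)"
proof -
  have "1 - 2 / (A + 1) * h = (A + 1 - 2 * h) / (A + 1)"
    using assms by (simp add: diff_divide_distrib)
  then have "\<bar>1 - 2 / (A + 1) * h\<bar> = \<bar>A + 1 - 2 * h\<bar> / (A + 1)"
    using assms by simp
  also have "\<dots> \<le> (A - 1) / (A + 1)"
    using assms by (intro divide_right_mono) auto
  finally show ?thesis .
qed

lemma ratapprox_of_separates:
  fixes T F :: "(real ^ 'v::finite) set"
  assumes "separates d T F c" "0 < c"
    and fT: "\<And>x. x \<in> T \<Longrightarrow> f x = -1" and fF: "\<And>x. x \<in> F \<Longrightarrow> f x = 1"
  shows "ratapprox (2 * d) (T \<union> F) f ((sqrt (1 + c) - 1) / (sqrt (1 + c) + 1))"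
proof -
  obtain p q where pq: "p \<in> polyfuns d" "q \<in> polyfuns d"
    and T: "\<And>x. x \<in> T \<Longrightarrow> q x \<noteq> 0 \<and> 0 < p x / q x \<and> p x / q x \<le> c"
    and F: "\<And>x. x \<in> F \<Longrightarrow> q x \<noteq> 0 \<and> p x / q x \<le> -1"
    using assms(1) unfolding separates_def by blast
  define A where "A = sqrt (1 + c)"
  define h where "h z = (c + 2 * c * z - z\<^sup>2) / (c + z\<^sup>2)" for z
  \<comment> \<open>\<open>P / Q\<close> is the rescaled \<open>h (p / q)\<close> with denominators
    cleared by \<open>q * q\<close>, whence degree \<open>2 * d\<close>. The minus sign is there
    because true is -1 while \<open>p / q\<close> is positive on \<open>T\<close>.\<close>
  define P where "P x = (-2 / (A + 1)) * (c * (q x * q x) + ((2 * c) * (p x * q x) + (-1) * (p x * p x)))"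
    for x
  define Q where "Q x = c * (q x * q x) + p x * p x" for x
  have PQ: "P \<in> polyfuns (d + d)" "Q \<in> polyfuns (d + d)"
    unfolding P_def Q_def by (intro polyfuns_cmult polyfuns_add polyfuns_mult pq)+
  have Q: "Q x \<noteq> 0" if "q x \<noteq> 0" for x
  proof -
    have "0 < c * (q x * q x)"
      using that assms(2) by (simp add: zero_less_mult_iff linorder_neq_iff[symmetric])
    then have "0 < Q x"
      unfolding Q_def by (intro add_pos_nonneg) auto
    then show ?thesis by simp
  qed
  have quot: "P x / Q x = - (2 / (A + 1) * h (p x / q x))" if "q x \<noteq> 0" for x
  proof -
    have "h (p x / q x) = (c * (q x * q x) + 2 * c * (p x * q x) - p x * p x) / Q x"
    proof -
      have "c + 2 * c * (p x / q x) - (p x / q x)\<^sup>2 =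
          (c * (q x * q x) + 2 * c * (p x * q x) - p x * p x) / (q x * q x)"
        "c + (p x / q x)\<^sup>2 = Q x / (q x * q x)"
        using that by (simp_all add: Q_def field_simps power2_eq_square)
      then show ?thesis
        using that by (simp add: h_def)
    qed
    moreover have "P x = - (2 / (A + 1)) * (c * (q x * q x) + 2 * c * (p x * q x) - p x * p x)"
      by (simp add: P_def)
    ultimately show ?thesis
      by simp
  qed
  have "\<bar>f x - P x / Q x\<bar> \<le> (A - 1) / (A + 1)" if "x \<in> T" for x
    using quot[of x] T[OF that] fT[OF that]
      rescaled_error[of "h (p x / q x)" A]
      quadratic_sign_approximant(1)[OF assms(2), of "p x / q x"]
    by (simp add: A_def h_def abs_le_iff)
  moreover have "\<bar>f x - P x / Q x\<bar> \<le> (A - 1) / (A + 1)" if "x \<in> F" for x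
    using quot[of x] F[OF that] fF[OF that]
      rescaled_error[of "- h (p x / q x)" A]
      quadratic_sign_approximant(2)[OF assms(2), of "p x / q x"]
    by (simp add: A_def h_def abs_le_iff)
  ultimately show ?thesis
    unfolding A_def[symmetric] using PQ Q T F by (intro ratapproxI[of P _ Q]) (auto simp: mult_2)
qed

text \<open>Since \<open>A > 1\<close>, \<open>(A - 1)\<^sup>2 \<le> (A - 1) * (A + 1) = c\<close>,
  and likewise for \<open>B\<close> with \<open>2 / c\<close>. The product of the squares is thus at
  most 2, well below the 16 that the criterion \<open>(A - 1) * (B - 1) < 4\<close> allows.\<close>

lemma rescaled_errors_add:
  fixes c :: real
  assumes "0 < c"
  shows "(sqrt (1 + c) - 1) / (sqrt (1 + c) + 1) + (sqrt (1 + 2 / c) - 1) / (sqrt (1 + 2 / c) + 1) < 1"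
proof -
  define A B where "A = sqrt (1 + c)" and "B = sqrt (1 + 2 / c)"
  have AB: "1 < A" "A\<^sup>2 = 1 + c" "1 < B" "B\<^sup>2 = 1 + 2 / c"
    using assms by (auto simp: A_def B_def)
  have "(A - 1)\<^sup>2 \<le> c" "(B - 1)\<^sup>2 \<le> 2 / c"
    using AB by (simp_all add: power2_eq_square algebra_simps)
  then have "(A - 1)\<^sup>2 * (B - 1)\<^sup>2 \<le> c * (2 / c)"
    using assms by (intro mult_mono) auto
  then have "((A - 1) * (B - 1))\<^sup>2 < 4\<^sup>2"
    using assms by (simp add: power_mult_distrib)
  then have "(A - 1) * (B - 1) < 4"
    by (rule power_less_imp_less_base) simp
  then have "(A - 1) / (A + 1) + (B - 1) / (B + 1) < 1"
  proof -
    have "(A - 1) / (A + 1) + (B - 1) / (B + 1) =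
        ((A - 1) * (B + 1) + (B - 1) * (A + 1)) / ((A + 1) * (B + 1))"
      using AB by (simp add: add_frac_eq)
    also have "\<dots> < 1"
      using AB \<open>(A - 1) * (B - 1) < 4\<close> mult_pos_pos[of "A + 1" "B + 1"]
      by (subst pos_divide_less_eq) (simp_all add: algebra_simps)
    finally show ?thesis .
  qed
  then show ?thesis
    by (simp add: A_def B_def)
qed

section \<open>Degenerate cases and assembly\<close>

text \<open>Covers the case where the other function is identically true. Divided by its largest
  modulus (at least 1), \<open>s\<close> has the sign of \<open>f\<close> and modulus in
  \<open>[m / K, 1]\<close>. Inserting 1 keeps \<open>Min\<close> and \<open>Max\<close> meaningful
  on an empty \<open>X\<close>.\<close>

lemma ratapprox_of_sign_representation:
  assumes "finite X" "s \<in> polyfuns d" "\<And>x. x \<in> X \<Longrightarrow> f x \<in> {-1, 1} \<and> 0 < f x * s x"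
  shows "\<exists>e<1. ratapprox d X f e"
proof -
  define m where "m = Min (insert 1 ((\<lambda>x. \<bar>s x\<bar>) ` X))"
  define K where "K = Max (insert 1 ((\<lambda>x. \<bar>s x\<bar>) ` X))"
  have m: "0 < m" "\<And>x. x \<in> X \<Longrightarrow> m \<le> \<bar>s x\<bar>"
    using assms by (fastforce simp: m_def)+
  have K: "1 \<le> K" "\<And>x. x \<in> X \<Longrightarrow> \<bar>s x\<bar> \<le> K"
    using assms(1) by (auto simp: K_def)
  have "\<bar>f x - (1 / K) * s x\<bar> \<le> 1 - m / K" if "x \<in> X" for x
  proof -
    have "m / K \<le> \<bar>s x\<bar> / K" "\<bar>s x\<bar> / K \<le> 1"
      using m K that by (auto intro: divide_right_mono)
    moreover have "f x = -1 \<and> \<bar>s x\<bar> = - s x \<or> f x = 1 \<and> \<bar>s x\<bar> = s x"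
      using assms(3)[OF that] by auto
    ultimately show ?thesis
      by (auto simp: abs_le_iff)
  qed
  then have "ratapprox d X f (1 - m / K)"
    using polyfuns_cmult[OF assms(2), of "1 / K"] polyfuns_const[of 1 d]
    by (intro ratapproxI[of "\<lambda>x. (1 / K) * s x" _ "\<lambda>x. 1"]) auto
  moreover have "1 - m / K < 1"
    using m K by simp
  ultimately show ?thesis by blast
qed

lemma ratapprox_const: "(\<And>x. x \<in> X \<Longrightarrow> f x = a) \<Longrightarrow> ratapprox d X f 0"
  by (rule ratapproxI[of "\<lambda>x. a" _ "\<lambda>x. 1"]) (auto intro: polyfuns_const)

lemma ratapprox_conjunction:
  fixes X :: "(real ^ 'n::finite) set" and Y :: "(real ^ 'm::finite) set"
  assumes fin: "finite X" "finite Y"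
    and f: "f \<in> X \<rightarrow> {-1, 1}" and g: "g \<in> Y \<rightarrow> {-1, 1}"
    and ne: "\<not> (\<forall>x\<in>X. f x = 1)" "\<not> (\<forall>y\<in>Y. g y = 1)"
    and d: "d = threshold_degree (vec_times X Y) (conj_fun f g)"
  shows "\<exists>e1 e2. e1 + e2 < 1 \<and> ratapprox (2 * d) X f e1 \<and> ratapprox (2 * d) Y g e2"
proof -
  have "finite (vec_times X Y)"
    using fin by (simp add: vec_times_def)
  moreover have "conj_fun f g z \<noteq> 0" for z
    by (simp add: conj_fun_def sign_and_def)
  ultimately obtain r where r: "total_degree r = d"
    "\<And>z. z \<in> vec_times X Y \<Longrightarrow> conj_fun f g z * eval_rpoly r z > 0"
    unfolding d using threshold_degree_attained[of "vec_times X Y" "conj_fun f g"] by blast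
  \<comment> \<open>The sign flip makes \<open>\<phi>\<close> positive exactly where both functions
    are true, which are the points where the conjunction is -1.\<close>
  define \<phi> where "\<phi> x y = (-1) * eval_rpoly r (vec_append x y)" for x y
  have sgn: "0 < - (sign_and (f x) (g y) * \<phi> x y)" if "x \<in> X" "y \<in> Y" for x y
    using r(2)[of "vec_append x y"] that by (auto simp: vec_times_def \<phi>_def conj_fun_append)
  have "eval_rpoly r \<in> polyfuns d"
    using r(1) by (intro polyfuns_eval_rpoly) simp
  then have deg: "\<phi> x \<in> polyfuns d" "(\<lambda>x. \<phi> x y) \<in> polyfuns d" for x y
    unfolding \<phi>_def[abs_def]
    by (rule polyfuns_cmult[OF polyfuns_section_right] polyfuns_cmult[OF polyfuns_section_left])+
  define T F where "T = {x\<in>X. f x = -1}" and "F = {x\<in>X. f x = 1}"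
  define T' F' where "T' = {y\<in>Y. g y = -1}" and "F' = {y\<in>Y. g y = 1}"
  have X: "X = T \<union> F" and Y: "Y = T' \<union> F'"
    using f g by (auto simp: T_def F_def T'_def F'_def)
  have val: "x \<in> T \<Longrightarrow> f x = -1" "x \<in> F \<Longrightarrow> f x = 1" "y \<in> T' \<Longrightarrow> g y = -1" "y \<in> F' \<Longrightarrow> g y = 1"
    for x y
    by (auto simp: T_def F_def T'_def F'_def)
  have fins: "finite T" "finite F" "finite T'" "finite F'"
    using fin X Y by auto
  have TT: "0 < \<phi> x y" if "x \<in> T" "y \<in> T'" for x y
    using sgn[of x y] that by (simp add: X Y val sign_and_def)
  have TF: "\<phi> x y < 0" if "x \<in> T" "y \<in> F'" for x y
    using sgn[of x y] that by (simp add: X Y val sign_and_def)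
  have FY: "\<phi> x y < 0" if "x \<in> F" "y \<in> T' \<union> F'" for x y
    using sgn[of x y] that by (auto simp: X Y val sign_and_def)
  obtain t t' where t: "t \<in> T" "t' \<in> T'"
    using ne unfolding X Y by (auto simp: val)
  consider "F = {}" | "F' = {}" | "F \<noteq> {}" "F' \<noteq> {}"
    by blast
  then show ?thesis
  proof cases
    case 1
    \<comment> \<open>Here \<open>f\<close> is constantly -1, hence approximated without error, and
      the conjunction at \<open>t\<close> is just \<open>g\<close>, so a single section
      sign-represents \<open>g\<close>.\<close>
    have "(\<lambda>y. (-1) * \<phi> t y) \<in> polyfuns d"
      using deg by (intro polyfuns_cmult) auto
    moreover have "g y \<in> {-1, 1} \<and> 0 < g y * ((-1) * \<phi> t y)" if "y \<in> Y" for y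
      using that t TT[of t y] TF[of t y] unfolding Y by (auto simp: val)
    ultimately obtain e where "e < 1" "ratapprox d Y g e"
      using ratapprox_of_sign_representation[OF fin(2)] by blast
    moreover have "ratapprox d X f 0"
      using 1 by (intro ratapprox_const[of _ _ "-1"]) (auto simp: X val)
    ultimately show ?thesis
      using ratapprox_mono[of d _ _ _ "2 * d"] by (metis add_0_left mult_2 le_add1)
  next
    case 2
    have "(\<lambda>x. (-1) * \<phi> x t') \<in> polyfuns d"
      using deg by (intro polyfuns_cmult) auto
    moreover have "f x \<in> {-1, 1} \<and> 0 < f x * ((-1) * \<phi> x t')" if "x \<in> X" for x
      using that t TT[of x t'] FY[of x t'] unfolding X by (auto simp: val)
    ultimately obtain e where "e < 1" "ratapprox d X f e"
      using ratapprox_of_sign_representation[OF fin(1)] by blast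
    moreover have "ratapprox d Y g 0"
      using 2 by (intro ratapprox_const[of _ _ "-1"]) (auto simp: Y val)
    ultimately show ?thesis
      using ratapprox_mono[of d _ _ _ "2 * d"] by (metis add_0_right mult_2 le_add1)
  next
    case 3
    then obtain s s' where s: "s \<in> F" "s' \<in> F'"
      by blast
    obtain c0 where c0: "0 < c0" "separates d T F c0"
      using separates_of_sign_pattern[of T F "\<lambda>x. \<phi> x t'" d "\<lambda>x. \<phi> x s'"] fins deg t s TT TF FY
      by blast
    obtain C where C: "0 < C" "separates d T' F' C"
      using separates_of_sign_pattern[of T' F' "\<phi> t" d "\<phi> s"] fins deg t s TT TF FY
      by blast
    have "separates d T F c \<or> separates d T' F' (1 / c)" if "0 < c" for c
      using fins t s deg TT TF FY that
      by (intro separates_alternative[of T F T' F' \<phi>]) (auto simp: T_def F_def T'_def F'_def)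
    then obtain c where c: "0 < c" "separates d T F c" "separates d T' F' (2 / c)"
      using separates_balanced[OF c0 C] by blast
    have "ratapprox (2 * d) X f ((sqrt (1 + c) - 1) / (sqrt (1 + c) + 1))"
      unfolding X using c by (intro ratapprox_of_separates) (auto simp: val)
    moreover have "ratapprox (2 * d) Y g ((sqrt (1 + 2 / c) - 1) / (sqrt (1 + 2 / c) + 1))"
      unfolding Y using c by (intro ratapprox_of_separates) (auto simp: val)
    ultimately show ?thesis
      using rescaled_errors_add[OF c(1)] by blast
  qed
qed

theorem theorem1p4:
  fixes X Y :: "(real ^ 'n::finite) set"
    and f g :: "real ^ 'n \<Rightarrow> real"
    and d :: nat
  assumes "finite X" and "finite Y"
    and "f \<in> X \<rightarrow> {-1, 1}" and "g \<in> Y \<rightarrow> {-1, 1}"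
    and "\<not> (\<forall>x\<in>X. f x = 1)" and "\<not> (\<forall>y\<in>Y. g y = 1)"
    and "d = threshold_degree (vec_times X Y) (conj_fun f g)"
  shows "\<exists>p1 q1 p2 q2 :: 'n rpoly.
      ratfun_degree p1 q1 \<le> 4 * d \<and> ratfun_degree p2 q2 \<le> 4 * d \<and>
      (\<forall>x\<in>X. eval_rpoly q1 x \<noteq> 0) \<and> (\<forall>y\<in>Y. eval_rpoly q2 y \<noteq> 0) \<and>
      Max ((\<lambda>x. \<bar>f x - eval_rpoly p1 x / eval_rpoly q1 x\<bar>) ` X) +
      Max ((\<lambda>y. \<bar>g y - eval_rpoly p2 y / eval_rpoly q2 y\<bar>) ` Y) < 1"
proof -
  obtain e1 e2 where e: "e1 + e2 < 1" "ratapprox (2 * d) X f e1" "ratapprox (2 * d) Y g e2"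
    using ratapprox_conjunction[OF assms] by blast
  obtain p1 q1 where 1: "total_degree p1 \<le> 2 * d" "total_degree q1 \<le> 2 * d"
    "\<forall>x\<in>X. eval_rpoly q1 x \<noteq> 0 \<and> \<bar>f x - eval_rpoly p1 x / eval_rpoly q1 x\<bar> \<le> e1"
    using e(2) unfolding ratapprox_def polyfuns_def by blast
  obtain p2 q2 where 2: "total_degree p2 \<le> 2 * d" "total_degree q2 \<le> 2 * d"
    "\<forall>y\<in>Y. eval_rpoly q2 y \<noteq> 0 \<and> \<bar>g y - eval_rpoly p2 y / eval_rpoly q2 y\<bar> \<le> e2"
    using e(3) unfolding ratapprox_def polyfuns_def by blast
  \<comment> \<open>\<open>Max\<close> is bounded by its elements only over a nonempty set; a
    function that is not identically false has a nonempty domain.\<close>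
  have "X \<noteq> {}" "Y \<noteq> {}"
    using assms by auto
  then have "Max ((\<lambda>x. \<bar>f x - eval_rpoly p1 x / eval_rpoly q1 x\<bar>) ` X) \<le> e1"
    "Max ((\<lambda>y. \<bar>g y - eval_rpoly p2 y / eval_rpoly q2 y\<bar>) ` Y) \<le> e2"
    using assms(1,2) 1 2 by auto
  with e(1) 1 2 show ?thesis
    by (intro exI[of _ p1, OF exI[of _ q1, OF exI[of _ p2, OF exI[of _ q2]]]]) (auto simp: ratfun_degree_def)
qed

end
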